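(* There is an algorithm using space polynomial in $n$ which, given a permutation $t:[n]\to[n]$ and a permutation $\pi:[k]\to[k]$ with $n\ge k$, decides whether $t$ contains $\pi$, and whose running time is both $n^{k/2+o(k)}$ and $O(1.6181^n)$.
   Context: $[n]=\{1,\dots,n\}$. A permutation $t:[n]\to[n]$ contains $\pi:[k]\to[k]$ if there are indices $1\le i_1<\dots<i_k\le n$ such that for all $1\le j,\ell\le k$, $t(i_j)<t(i_\ell)$ if and only if $\pi(j)<\pi(\ell)$; otherwise $t$ avoids $\pi$. *)

theory Defs
  imports Complex_Main "HOL-Library.Landau_Symbols" "HOL-Library.Log_Nat"
    "HOL-Combinatorics.Permutations"
begin

section \<open>Pattern containment\<close>

definition perm_contains :: "nat \<Rightarrow> (nat \<Rightarrow> nat) \<Rightarrow> nat \<Rightarrow> (nat \<Rightarrow> nat) \<Rightarrow> bool" where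
  "perm_contains n t k \<pi> \<longleftrightarrow>
     (\<exists>i. strict_mono_on {1..k} i \<and> i ` {1..k} \<subseteq> {1..n} \<and>
          (\<forall>j\<in>{1..k}. \<forall>l\<in>{1..k}. t (i j) < t (i l) \<longleftrightarrow> \<pi> j < \<pi> l))"


section \<open>Random access machines with logarithmic cost\<close>

text \<open>The machine has registers indexed by the natural numbers, all initially 0 and each holding
  a natural number, and a read-only input, which is a list of natural numbers. \<open>Fetch\<close> reads the
  input at a computed position, \<open>Load\<close> and \<open>Store\<close> are the indirect register accesses, and \<open>Sub\<close>
  is truncated subtraction. A computation halts when the program counter leaves the program; the
  output is then found in register 0.\<close>

datatype instr =
    Const nat nat
  | Copy nat nat
  | Add nat nat nat
  | Sub nat nat nat
  | Load nat nat
  | Store nat nat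
  | Fetch nat nat
  | Jump nat
  | JumpZero nat nat

type_synonym program = "instr list"
type_synonym config = "nat \<times> (nat \<Rightarrow> nat)"

definition input_at :: "nat list \<Rightarrow> nat \<Rightarrow> nat" where
  "input_at x i = (if i < length x then x ! i else 0)"

fun exec :: "nat list \<Rightarrow> instr \<Rightarrow> config \<Rightarrow> config" where
  "exec x (Const i c) (pc, m) = (Suc pc, m(i := c))"
| "exec x (Copy i j) (pc, m) = (Suc pc, m(i := m j))"
| "exec x (Add i j l) (pc, m) = (Suc pc, m(i := m j + m l))"
| "exec x (Sub i j l) (pc, m) = (Suc pc, m(i := m j - m l))"
| "exec x (Load i j) (pc, m) = (Suc pc, m(i := m (m j)))"
| "exec x (Store i j) (pc, m) = (Suc pc, m(m i := m j))"
| "exec x (Fetch i j) (pc, m) = (Suc pc, m(i := input_at x (m j)))"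
| "exec x (Jump q) (pc, m) = (q, m)"
| "exec x (JumpZero i q) (pc, m) = (if m i = 0 then q else Suc pc, m)"

definition halted :: "program \<Rightarrow> config \<Rightarrow> bool" where
  "halted P c \<longleftrightarrow> length P \<le> fst c"

definition ram_step :: "program \<Rightarrow> nat list \<Rightarrow> config \<Rightarrow> config" where
  "ram_step P x c = (if halted P c then c else exec x (P ! fst c) c)"

definition ram_run :: "program \<Rightarrow> nat list \<Rightarrow> nat \<Rightarrow> config" where
  "ram_run P x i = (ram_step P x ^^ i) (0, \<lambda>_. 0)"

definition ram_halts :: "program \<Rightarrow> nat list \<Rightarrow> bool" where
  "ram_halts P x \<longleftrightarrow> (\<exists>N. halted P (ram_run P x N))"

definition ram_steps :: "program \<Rightarrow> nat list \<Rightarrow> nat" where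
  "ram_steps P x = (LEAST N. halted P (ram_run P x N))"

definition ram_output :: "program \<Rightarrow> nat list \<Rightarrow> nat" where
  "ram_output P x = snd (ram_run P x (ram_steps P x)) 0"

definition bit_length :: "nat \<Rightarrow> nat" where
  "bit_length a = max 1 (floorlog 2 a)"

text \<open>Logarithmic cost: an instruction is charged the bit lengths of all numbers it handles, both
  the register addresses and the contents, so that arithmetic on large numbers is not free.\<close>

fun instr_cost :: "nat list \<Rightarrow> instr \<Rightarrow> (nat \<Rightarrow> nat) \<Rightarrow> nat" where
  "instr_cost x (Const i c) m = bit_length i + bit_length c"
| "instr_cost x (Copy i j) m = bit_length i + bit_length j + bit_length (m j)"
| "instr_cost x (Add i j l) m =
     bit_length i + bit_length j + bit_length l + bit_length (m j) + bit_length (m l)"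
| "instr_cost x (Sub i j l) m =
     bit_length i + bit_length j + bit_length l + bit_length (m j) + bit_length (m l)"
| "instr_cost x (Load i j) m =
     bit_length i + bit_length j + bit_length (m j) + bit_length (m (m j))"
| "instr_cost x (Store i j) m =
     bit_length i + bit_length j + bit_length (m i) + bit_length (m j)"
| "instr_cost x (Fetch i j) m =
     bit_length i + bit_length j + bit_length (m j) + bit_length (input_at x (m j))"
| "instr_cost x (Jump q) m = 1"
| "instr_cost x (JumpZero i q) m = bit_length i + bit_length (m i)"

definition ram_time :: "program \<Rightarrow> nat list \<Rightarrow> nat" where
  "ram_time P x =
     (\<Sum>s<ram_steps P x. case ram_run P x s of (pc, m) \<Rightarrow> instr_cost x (P ! pc) m)"

text \<open>The space of a configuration is the number of bits needed to list its nonzero registers with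
  their addresses. Only finitely many registers are nonzero in a reachable configuration (lemma
  \<open>finite_nonzero_registers\<close> below), so this sum is a genuine one.\<close>

definition config_space :: "config \<Rightarrow> nat" where
  "config_space c = (\<Sum>r | snd c r \<noteq> 0. bit_length r + bit_length (snd c r))"

definition ram_space :: "program \<Rightarrow> nat list \<Rightarrow> nat" where
  "ram_space P x = (MAX s\<in>{..ram_steps P x}. config_space (ram_run P x s))"

lemma finite_nonzero_registers: "finite {r. snd (ram_run P x s) r \<noteq> 0}"
proof (induction s)
  case 0
  then show ?case by (simp add: ram_run_def)
next
  case (Suc s)
  have upd: "finite {r. 0 < (m(i := v)) r}" if "finite {r. 0 < m r}"
    for m :: "nat \<Rightarrow> nat" and i v
    by (rule finite_subset[OF _ finite.insertI[OF that, of i]]) auto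
  have exec: "finite {r. snd (exec x I c) r \<noteq> 0}" if "finite {r. snd c r \<noteq> 0}" for I c
    using that by (cases c; cases I) (simp_all add: upd del: fun_upd_apply)
  have "ram_run P x (Suc s) = ram_step P x (ram_run P x s)"
    by (simp add: ram_run_def)
  then show ?case
    using Suc exec by (simp add: ram_step_def)
qed


section \<open>Deciding pattern containment\<close>

definition encode :: "nat \<Rightarrow> (nat \<Rightarrow> nat) \<Rightarrow> nat \<Rightarrow> (nat \<Rightarrow> nat) \<Rightarrow> nat list" where
  "encode n t k \<pi> = [n, k] @ map t [1..<Suc n] @ map \<pi> [1..<Suc k]"

definition decides_containment :: "program \<Rightarrow> bool" where
  "decides_containment P \<longleftrightarrow>
     (\<forall>n k t \<pi>. t permutes {1..n} \<and> \<pi> permutes {1..k} \<and> k \<le> n \<longrightarrow>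
        ram_halts P (encode n t k \<pi>) \<and>
        ram_output P (encode n t k \<pi>) = (if perm_contains n t k \<pi> then 1 else 0))"

definition worst_case :: "(nat list \<Rightarrow> nat) \<Rightarrow> nat \<Rightarrow> nat \<Rightarrow> nat" where
  "worst_case f n k = Max {f (encode n t k \<pi>) | t \<pi>. t permutes {1..n} \<and> \<pi> permutes {1..k}}"

lemma worst_case_set:
  "finite {f (encode n t k \<pi>) | t \<pi>. t permutes {1..n} \<and> \<pi> permutes {1..k}}"
  "{f (encode n t k \<pi>) | t \<pi>. t permutes {1..n} \<and> \<pi> permutes {1..k}} \<noteq> {}"
proof -
  have "{f (encode n t k \<pi>) | t \<pi>. t permutes {1..n} \<and> \<pi> permutes {1..k}} =
      (\<lambda>(t, \<pi>). f (encode n t k \<pi>)) ` ({t. t permutes {1..n}} \<times> {\<pi>. \<pi> permutes {1..k}})"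
    by auto
  then show "finite {f (encode n t k \<pi>) | t \<pi>. t permutes {1..n} \<and> \<pi> permutes {1..k}}"
    by (simp add: finite_permutations)
  show "{f (encode n t k \<pi>) | t \<pi>. t permutes {1..n} \<and> \<pi> permutes {1..k}} \<noteq> {}"
    using permutes_id by blast
qed

end

theory Submission
  imports Defs "HOL-Real_Asymp.Real_Asymp"
begin

text \<open>A copy of the pattern in the text assigns to the pattern values increasing text values.
  Once the text values for the even pattern values are chosen, each odd pattern value only has to
  land strictly between its two even neighbours, so a greedy sweep over the text positions decides
  whether the choice extends to a copy. Chosen values are at least 2 apart; hence there are at most
  \<open>n ^ (k div 2)\<close> choices, and counting the nodes of the backtracking tree by whether the next
  value is chosen gives the Fibonacci recursion, hence a bound \<open>O(a ^ n)\<close> whenever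
  \<open>a\<^sup>2 \<ge> a + 1\<close>. With \<open>a = 1.61804\<close>, the polynomial cost of a sweep still fits under
  \<open>1.6181 ^ n\<close>.\<close>


section \<open>Bounded runs\<close>

text \<open>A single bound on contents and on addresses in use serves twice: it limits the bit
  lengths charged to an instruction, and the number and size of the registers that count as
  space.\<close>

definition mem_bounded :: "nat \<Rightarrow> (nat \<Rightarrow> nat) \<Rightarrow> bool" where
  "mem_bounded B m \<longleftrightarrow> (\<forall>r. m r \<le> B \<and> (m r \<noteq> 0 \<longrightarrow> r \<le> B))"

lemma mem_boundedD: "mem_bounded B m \<Longrightarrow> m r \<le> B"
  by (simp add: mem_bounded_def)

lemma mem_bounded_update [simp]:
  "mem_bounded B m \<Longrightarrow> i \<le> B \<Longrightarrow> v \<le> B \<Longrightarrow> mem_bounded B (m(i := v))"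
  by (simp add: mem_bounded_def)

text \<open>Recursion on the number of steps lets the simplifier execute code symbolically. Halting
  is excluded before the last step, so the length of a run that ends halted is determined.\<close>

primrec steps_to ::
  "program \<Rightarrow> nat list \<Rightarrow> nat \<Rightarrow> (config \<Rightarrow> bool) \<Rightarrow> nat \<Rightarrow> config \<Rightarrow> bool" where
  "steps_to P x B Q 0 c \<longleftrightarrow> mem_bounded B (snd c) \<and> Q c"
| "steps_to P x B Q (Suc N) c \<longleftrightarrow>
     mem_bounded B (snd c) \<and> \<not> halted P c \<and> steps_to P x B Q N (ram_step P x c)"

lemma steps_to_numeral:
  "steps_to P x B Q (numeral w) c \<longleftrightarrow>
     mem_bounded B (snd c) \<and> \<not> halted P c \<and> steps_to P x B Q (pred_numeral w) (ram_step P x c)"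
  by (simp add: numeral_eq_Suc)

lemma steps_to_iff:
  "steps_to P x B Q N c \<longleftrightarrow>
     (\<forall>s\<le>N. mem_bounded B (snd ((ram_step P x ^^ s) c))) \<and>
     (\<forall>s<N. \<not> halted P ((ram_step P x ^^ s) c)) \<and> Q ((ram_step P x ^^ N) c)"
proof (induction N arbitrary: c)
  case (Suc N)
  have all_le: "(\<forall>s\<le>Suc N. R s) \<longleftrightarrow> R 0 \<and> (\<forall>s\<le>N. R (Suc s))" for R :: "nat \<Rightarrow> bool"
    by (metis Suc_le_mono not0_implies_Suc zero_le)
  have all_less: "(\<forall>s<Suc N. R s) \<longleftrightarrow> R 0 \<and> (\<forall>s<N. R (Suc s))" for R :: "nat \<Rightarrow> bool"
    by (metis Suc_less_eq not0_implies_Suc zero_less_Suc)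
  show ?case
    unfolding all_le all_less by (auto simp: Suc funpow_Suc_right simp del: funpow.simps)
qed simp

lemma steps_to_add:
  "steps_to P x B Q N c \<Longrightarrow> (\<And>c'. Q c' \<Longrightarrow> steps_to P x B R (M c') c') \<Longrightarrow>
     \<exists>c'. Q c' \<and> steps_to P x B R (N + M c') c"
  by (induction N arbitrary: c) auto

definition reaches ::
  "program \<Rightarrow> nat list \<Rightarrow> nat \<Rightarrow> (config \<Rightarrow> bool) \<Rightarrow> nat \<Rightarrow> config \<Rightarrow> bool" where
  "reaches P x B Q T c \<longleftrightarrow> (\<exists>N\<le>T. steps_to P x B Q N c)"

lemma steps_to_imp_reaches: "steps_to P x B Q N c \<Longrightarrow> N \<le> T \<Longrightarrow> reaches P x B Q T c"
  by (auto simp: reaches_def)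

lemma reaches_trans:
  assumes "reaches P x B Q N c" "\<And>c'. Q c' \<Longrightarrow> reaches P x B R M c'" "N + M \<le> T"
  shows "reaches P x B R T c"
proof -
  obtain N' where N': "N' \<le> N" "steps_to P x B Q N' c"
    using assms(1) by (auto simp: reaches_def)
  \<comment> \<open>The length of the second run may depend on where the first one ends, so a choice
    function is extracted.\<close>
  have "\<exists>M'. \<forall>c'. Q c' \<longrightarrow> M' c' \<le> M \<and> steps_to P x B R (M' c') c'"
    using assms(2) unfolding reaches_def by metis
  then obtain M' where M': "\<And>c'. Q c' \<Longrightarrow> M' c' \<le> M \<and> steps_to P x B R (M' c') c'"
    by blast
  then obtain c' where "Q c'" "steps_to P x B R (N' + M' c') c"
    using steps_to_add[OF N'(2), of R M'] by blast
  moreover have "N' + M' c' \<le> T"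
    using N'(1) M'[OF \<open>Q c'\<close>] assms(3) by linarith
  ultimately show ?thesis
    by (auto simp: reaches_def)
qed

lemmas steps_then = reaches_trans[OF steps_to_imp_reaches[OF _ order_refl]]

section \<open>Cost and space of bounded runs\<close>

fun operands_le :: "nat \<Rightarrow> instr \<Rightarrow> bool" where
  "operands_le B (Const i c) \<longleftrightarrow> i \<le> B \<and> c \<le> B"
| "operands_le B (Copy i j) \<longleftrightarrow> i \<le> B \<and> j \<le> B"
| "operands_le B (Add i j l) \<longleftrightarrow> i \<le> B \<and> j \<le> B \<and> l \<le> B"
| "operands_le B (Sub i j l) \<longleftrightarrow> i \<le> B \<and> j \<le> B \<and> l \<le> B"
| "operands_le B (Load i j) \<longleftrightarrow> i \<le> B \<and> j \<le> B"
| "operands_le B (Store i j) \<longleftrightarrow> i \<le> B \<and> j \<le> B"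
| "operands_le B (Fetch i j) \<longleftrightarrow> i \<le> B \<and> j \<le> B"
| "operands_le B (Jump q) \<longleftrightarrow> True"
| "operands_le B (JumpZero i q) \<longleftrightarrow> i \<le> B"

text \<open>A linear bound is crude but costs only a polynomial factor later; the successor covers
  0, whose bit length is 1.\<close>

lemma bit_length_le:
  assumes "a \<le> B"
  shows "bit_length a \<le> Suc B"
proof -
  have "floorlog 2 a \<le> a"
    by (simp add: floorlog_le_iff)
  then show ?thesis
    using assms by (simp add: bit_length_def)
qed

text \<open>\<open>Add\<close> and \<open>Sub\<close> handle the most numbers, namely five.\<close>

lemma instr_cost_le:
  assumes "operands_le B I" "mem_bounded B m" "\<And>i. input_at x i \<le> B"
  shows "instr_cost x I m \<le> 5 * (B + 1)"
proof -
  have b: "bit_length (m r) \<le> Suc B" "bit_length (input_at x r) \<le> Suc B"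
    and c: "r \<le> B \<Longrightarrow> bit_length r \<le> Suc B" for r
    using assms(2,3) by (simp_all add: bit_length_le mem_boundedD)
  show ?thesis
  proof (cases I)
    case (Const i a)
    then show ?thesis using assms(1) c[of i] c[of a] by simp
  next
    case (Copy i j)
    then show ?thesis using assms(1) c[of i] c[of j] b(1)[of j] by simp
  next
    case (Add i j l)
    then show ?thesis using assms(1) c[of i] c[of j] c[of l] b(1)[of j] b(1)[of l] by simp
  next
    case (Sub i j l)
    then show ?thesis using assms(1) c[of i] c[of j] c[of l] b(1)[of j] b(1)[of l] by simp
  next
    case (Load i j)
    then show ?thesis using assms(1) c[of i] c[of j] b(1)[of j] b(1)[of "m j"] by simp
  next
    case (Store i j)
    then show ?thesis using assms(1) c[of i] c[of j] b(1)[of i] b(1)[of j] by simp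
  next
    case (Fetch i j)
    then show ?thesis using assms(1) c[of i] c[of j] b(1)[of j] b(2)[of "m j"] by simp
  next
    case (JumpZero i q)
    then show ?thesis using assms(1) c[of i] b(1)[of i] by simp
  qed simp
qed

lemma config_space_le:
  assumes "mem_bounded B (snd c)"
  shows "config_space c \<le> 2 * (B + 1)\<^sup>2"
proof -
  have sub: "{r. snd c r \<noteq> 0} \<subseteq> {..B}"
    using assms by (auto simp: mem_bounded_def)
  have "config_space c \<le> (\<Sum>r | snd c r \<noteq> 0. 2 * (B + 1))"
    unfolding config_space_def
  proof (rule sum_mono)
    fix r assume "r \<in> {r. snd c r \<noteq> 0}"
    then have "bit_length r \<le> Suc B" "bit_length (snd c r) \<le> Suc B"
      using sub by (auto intro!: bit_length_le simp: mem_boundedD[OF assms] simp del: One_nat_def)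
    then show "bit_length r + bit_length (snd c r) \<le> 2 * (B + 1)"
      by simp
  qed
  also have "\<dots> \<le> (B + 1) * (2 * (B + 1))"
    unfolding sum_constant of_nat_id using card_mono[OF _ sub] by (intro mult_right_mono) simp_all
  finally show ?thesis
    by (simp add: power2_eq_square algebra_simps)
qed

lemma reaches_halt:
  assumes "reaches P x B (\<lambda>c. halted P c \<and> snd c 0 = y) T (0, \<lambda>_. 0)"
    and "\<And>I. I \<in> set P \<Longrightarrow> operands_le B I" and "\<And>i. input_at x i \<le> B"
  shows "ram_halts P x" and "ram_output P x = y"
    and "ram_time P x \<le> T * (5 * (B + 1))" and "ram_space P x \<le> 2 * (B + 1)\<^sup>2"
proof -
  obtain N where "N \<le> T" and N: "steps_to P x B (\<lambda>c. halted P c \<and> snd c 0 = y) N (0, \<lambda>_. 0)"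
    using assms(1) by (auto simp: reaches_def)
  have bounded: "mem_bounded B (snd (ram_run P x s))" if "s \<le> N" for s
    using N that by (auto simp: steps_to_iff ram_run_def)
  have running: "\<not> halted P (ram_run P x s)" if "s < N" for s
    using N that by (auto simp: steps_to_iff ram_run_def)
  have final: "halted P (ram_run P x N)" "snd (ram_run P x N) 0 = y"
    using N by (auto simp: steps_to_iff ram_run_def)
  show "ram_halts P x"
    using final by (auto simp: ram_halts_def)
  have steps: "ram_steps P x = N"
    unfolding ram_steps_def
    using final(1) running by (intro Least_equality) (auto simp: not_less[symmetric])
  show "ram_output P x = y"
    using final by (simp add: ram_output_def steps)
  have "(case ram_run P x s of (pc, m) \<Rightarrow> instr_cost x (P ! pc) m) \<le> 5 * (B + 1)"
    if "s < N" for s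
  proof (cases "ram_run P x s")
    case (Pair pc m)
    then have "P ! pc \<in> set P" "mem_bounded B m"
      using running[OF that] bounded[of s] that by (simp_all add: halted_def)
    then have "instr_cost x (P ! pc) m \<le> 5 * (B + 1)"
      by (intro instr_cost_le assms)
    then show ?thesis
      using Pair by simp
  qed
  then have "ram_time P x \<le> N * (5 * (B + 1))"
    unfolding ram_time_def steps
    using sum_bounded_above[of "{..<N}" _ "5 * (B + 1)"] by (simp del: mult_Suc_right)
  also have "\<dots> \<le> T * (5 * (B + 1))"
    using \<open>N \<le> T\<close> by simp
  finally show "ram_time P x \<le> T * (5 * (B + 1))" .
  show "ram_space P x \<le> 2 * (B + 1)\<^sup>2"
    unfolding ram_space_def steps
    by (rule Max.boundedI) (auto simp del: Suc_eq_plus1 add_Suc_right simp: config_space_le[OF bounded, simplified])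
qed


section \<open>Greedy matching and the search\<close>

text \<open>\<open>R j q\<close> reads: pattern position \<open>j\<close> may be placed at text
  position \<open>q\<close>. The value is the number of pattern positions placed in a sweep that
  places each one as early as possible.\<close>

primrec greedy :: "(nat \<Rightarrow> nat \<Rightarrow> bool) \<Rightarrow> nat \<Rightarrow> nat" where
  "greedy R 0 = 0"
| "greedy R (Suc q) = (if R (Suc (greedy R q)) (Suc q) then Suc (greedy R q) else greedy R q)"

lemma greedy_sound:
  "\<exists>i. strict_mono_on {1..greedy R q} i \<and> i ` {1..greedy R q} \<subseteq> {1..q} \<and>
     (\<forall>j\<in>{1..greedy R q}. R j (i j))"
proof (induction q)
  case (Suc q)
  let ?g = "greedy R q"
  obtain i where i: "strict_mono_on {1..?g} i" "i ` {1..?g} \<subseteq> {1..q}" "\<forall>j\<in>{1..?g}. R j (i j)"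
    using Suc by blast
  show ?case
  proof (cases "R (Suc ?g) (Suc q)")
    case True
    let ?i = "i(Suc ?g := Suc q)"
    have "strict_mono_on {1..Suc ?g} ?i"
    proof (rule strict_mono_onI)
      fix r s assume "r \<in> {1..Suc ?g}" "s \<in> {1..Suc ?g}" "r < s"
      then have r: "r \<in> {1..?g}" "s = Suc ?g \<or> s \<in> {1..?g}"
        by auto
      then have "i r \<le> q"
        using i(2) by fastforce
      then show "?i r < ?i s"
        using r \<open>r < s\<close> strict_mono_onD[OF i(1)] by auto
    qed
    moreover have "?i ` {1..Suc ?g} \<subseteq> {1..Suc q}"
      using i(2) by (fastforce simp: le_Suc_eq)
    moreover have "\<forall>j\<in>{1..Suc ?g}. R j (?i j)"
      using i(3) True by (auto simp: le_Suc_eq)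
    moreover have "greedy R (Suc q) = Suc ?g"
      using True by simp
    ultimately show ?thesis
      by metis
  next
    case False
    then have "greedy R (Suc q) = ?g"
      by simp
    moreover have "i ` {1..?g} \<subseteq> {1..Suc q}"
      using i(2) by fastforce
    ultimately show ?thesis
      using i(1,3) by metis
  qed
qed simp

text \<open>The sweep stays ahead of every embedding: if the embedding uses the last text position,
  remove that point and apply the induction hypothesis.\<close>

lemma greedy_optimal:
  assumes "strict_mono_on {1..v} i" "i ` {1..v} \<subseteq> {1..q}" "\<forall>j\<in>{1..v}. R j (i j)"
  shows "v \<le> greedy R q"
  using assms
proof (induction q arbitrary: v)
  case 0
  then show ?case
    by (cases v) auto
next
  case (Suc q)
  show ?case
  proof (cases v)
    case (Suc w)
    have before: "i j \<in> {1..q}" if "j \<in> {1..w}" for j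
    proof -
      have "j \<in> {1..v}" "v \<in> {1..v}" "j < v"
        using that Suc by auto
      then have "i j < i v" "i j \<in> {1..Suc q}" "i v \<in> {1..Suc q}"
        using strict_mono_onD[OF Suc.prems(1)] Suc.prems(2) by blast+
      then show ?thesis
        by simp
    qed
    show ?thesis
    proof (cases "i v = Suc q")
      case True
      have "w \<le> greedy R q"
      proof (rule Suc.IH)
        show "strict_mono_on {1..w} i"
          using Suc.prems(1) by (rule monotone_on_subset) (simp add: Suc)
      qed (use before Suc.prems(3) Suc in auto)
      moreover have "R v (Suc q)"
        using True Suc Suc.prems(3) by force
      \<comment> \<open>Either the sweep stands at \<open>w\<close> and advances now, or it was
        already further.\<close>
      ultimately show ?thesis
        using Suc by (cases "greedy R q = w") auto
    next
      case False
      moreover have "i v \<in> {1..Suc q}"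
        using Suc.prems(2) Suc by force
      ultimately have "i j \<in> {1..q}" if "j \<in> {1..v}" for j
        using before[of j] that Suc by (cases "j = v") auto
      then have "i ` {1..v} \<subseteq> {1..q}"
        by blast
      from Suc.IH[OF Suc.prems(1) this Suc.prems(3)] show ?thesis
        by simp
    qed
  qed simp
qed

text \<open>The text values playing the pattern values \<open>2\<close>, \<open>4\<close>, ... are stored twice, as
  \<open>D (2 * j) = D (2 * j + 1)\<close>, so that the interval from \<open>D u\<close> to \<open>D (u + 1)\<close> is the slot of
  pattern value \<open>u\<close> for even and odd \<open>u\<close> alike. For odd \<open>u\<close> the end points need not be
  excluded, as they are already taken by other positions in a complete match.\<close>

definition fits :: "(nat \<Rightarrow> nat) \<Rightarrow> nat \<Rightarrow> (nat \<Rightarrow> nat) \<Rightarrow> (nat \<Rightarrow> nat) \<Rightarrow> nat \<Rightarrow> nat \<Rightarrow> bool" where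
  "fits t k \<pi> D v q \<longleftrightarrow> v \<le> k \<and> D (\<pi> v) \<le> t q \<and> t q \<le> D (Suc (\<pi> v))"

text \<open>For even \<open>J\<close>, this is the next pattern value to be placed, and
  \<open>x\<close> is the least text value still considered for it. Going on with
  \<open>x + 2\<close> leaves a text value for the odd pattern value in between. At a leaf,
  \<open>Suc n\<close> closes the slot of \<open>k\<close> when \<open>k\<close> is odd.\<close>

function search :: "nat \<Rightarrow> (nat \<Rightarrow> nat) \<Rightarrow> nat \<Rightarrow> (nat \<Rightarrow> nat) \<Rightarrow> nat \<Rightarrow> nat \<Rightarrow> (nat \<Rightarrow> nat) \<Rightarrow> bool" where
  "search n t k \<pi> J x D =
     (if k < J then greedy (fits t k \<pi> (D(J := Suc n))) n = k
      else if n < x then False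
      else search n t k \<pi> (J + 2) (x + 2) (D(J := x, Suc J := x)) \<or> search n t k \<pi> J (x + 1) D)"
  by auto
termination by (relation "measure (\<lambda>(n, t, k, \<pi>, J, x, D). Suc n - x)") auto

text \<open>Size of the search tree without early success, hence independent of the text, the
  pattern and \<open>D\<close>.\<close>

function visits :: "nat \<Rightarrow> nat \<Rightarrow> nat \<Rightarrow> nat \<Rightarrow> nat" where
  "visits n k J x =
     (if k < J \<or> n < x then 1 else 1 + visits n k (J + 2) (x + 2) + visits n k J (x + 1))"
  by auto
termination by (relation "measure (\<lambda>(n, k, J, x). Suc n - x)") auto

declare search.simps [simp del] visits.simps [simp del]


section \<open>The machine\<close>

text \<open>Registers: 1 and 7 hold \<open>n\<close> and \<open>n + 1\<close>, register 5 holds \<open>20 + J\<close>, register 6 holds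
  \<open>x\<close>, and register \<open>20 + u\<close> holds \<open>D u\<close>. Registers 8 and 9 are the input addresses of the
  current entries of \<open>t\<close> and \<open>\<pi>\<close>. The main loop starts at 11, the test of a complete choice
  at 23, its inner loop at 26, and backtracking at 48. A test that runs off the end of \<open>\<pi>\<close>
  fetches 0 and thereby the slot from \<open>D 0 = 0\<close> to \<open>D 1 = 0\<close>, which no text value fits.\<close>

definition containment_program :: program where
  "containment_program =
    [Const 2 1, Const 3 20, Fetch 1 0, Fetch 4 2, Add 7 1 2, Add 14 7 4, Add 4 4 3, Const 13 2,
     Add 5 3 13, Copy 15 5, Const 6 1,
     Sub 12 5 4, JumpZero 12 14, Jump 23,
     Sub 12 6 1, JumpZero 12 17, Jump 48,
     Store 5 6, Add 5 5 2, Store 5 6, Add 5 5 2, Add 6 6 13, Jump 11,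
     Store 5 7, Const 8 2, Add 9 7 2,
     Sub 12 8 7, JumpZero 12 29, Jump 44,
     Fetch 10 8, Add 8 8 2, Fetch 11 9, Add 11 11 3, Load 12 11, Sub 12 12 10, JumpZero 12 37,
     Jump 26,
     Add 11 11 2, Load 12 11, Sub 12 10 12, JumpZero 12 42, Jump 26,
     Add 9 9 2, Jump 26,
     Sub 12 9 14, JumpZero 12 48, Const 0 1, Jump 54,
     Sub 12 5 15, JumpZero 12 54, Sub 5 5 13, Load 6 5, Add 6 6 2, Jump 11]"

lemma operands_containment_program:
  "I \<in> set containment_program \<Longrightarrow> operands_le (b + 60) I"
  by (auto simp: containment_program_def)

locale containment_instance =
  fixes n k :: nat and t \<pi> :: "nat \<Rightarrow> nat"
  assumes t: "t permutes {1..n}" and pi: "\<pi> permutes {1..k}" and k_le_n: "k \<le> n"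
begin

text \<open>Input addresses reach \<open>2 * n + 2\<close> and register addresses of
  \<open>D\<close> reach \<open>n + 22\<close>; the summand 60 also covers the literal
  operands.\<close>

abbreviation "bound \<equiv> 2 * n + 60"

abbreviation "runs_to \<equiv> steps_to containment_program (encode n t k \<pi>) bound"
abbreviation "arrives \<equiv> reaches containment_program (encode n t k \<pi>) bound"

lemma t_range: "q \<in> {1..n} \<Longrightarrow> 1 \<le> t q \<and> t q \<le> n"
  using permutes_in_image[OF t, of q] by simp

lemma pi_range: "v \<in> {1..k} \<Longrightarrow> 1 \<le> \<pi> v \<and> \<pi> v \<le> k"
  using permutes_in_image[OF pi, of v] by simp

lemma input_at_encode:
  "input_at (encode n t k \<pi>) 0 = n"
  "input_at (encode n t k \<pi>) 1 = k"
  "input_at (encode n t k \<pi>) (Suc 0) = k"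
  "q < n \<Longrightarrow> input_at (encode n t k \<pi>) (q + 2) = t (Suc q)"
  "input_at (encode n t k \<pi>) (n + 2 + v) = (if v < k then \<pi> (Suc v) else 0)"
  by (simp_all add: input_at_def encode_def nth_append del: upt_Suc)

lemma input_at_le: "input_at (encode n t k \<pi>) i \<le> bound"
proof (cases "i < n + 2")
  case True
  then consider "i = 0" | "i = 1" | q where "i = q + 2" "q < n"
    by (metis One_nat_def add_2_eq_Suc' less_Suc0 less_Suc_eq_0_disj not0_implies_Suc
        add_less_cancel_right)
  then show ?thesis
    using k_le_n
  proof cases
    fix q assume "i = q + 2" "q < n"
    then show ?thesis
      using t_range[of "Suc q"] input_at_encode(4)[of q] by simp
  qed (simp_all add: input_at_encode)
next
  case False
  then obtain v where "i = n + 2 + v"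
    using le_Suc_ex not_le by blast
  then show ?thesis
    using k_le_n pi_range[of "Suc v"] by (cases "v < k") (simp_all only: input_at_encode, simp_all)
qed

section \<open>Register invariants and the test of a complete choice\<close>

definition ready :: "(nat \<Rightarrow> nat) \<Rightarrow> nat \<Rightarrow> bool" where
  "ready m J \<longleftrightarrow> mem_bounded bound m \<and> m 0 = 0 \<and> m 1 = n \<and> m 2 = 1 \<and> m 3 = 20 \<and>
     m 4 = 20 + k \<and> m 5 = 20 + J \<and> m 7 = n + 1 \<and> m 13 = 2 \<and> m 14 = n + k + 1 \<and> m 15 = 22 \<and>
     m 20 = 0 \<and> m 21 = 0"

lemma readyD:
  assumes "ready m J"
  shows "mem_bounded bound m" "m 0 = 0" "m 1 = n" "m (Suc 0) = n" "m 2 = 1" "m 3 = 20"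
    "m 4 = 20 + k" "m 5 = 20 + J" "m 7 = n + 1" "m 13 = 2" "m 14 = n + k + 1" "m 15 = 22"
    "m 20 = 0" "m 21 = 0"
  using assms by (simp_all add: ready_def)

lemmas run_simps = steps_to_numeral ram_step_def halted_def containment_program_def input_at_encode

lemma init_runs:
  "runs_to (\<lambda>(pc, m). pc = 11 \<and> ready m 2 \<and> m 6 = 1 \<and> (\<forall>u. m (20 + u) = 0)) 11 (0, \<lambda>_. 0)"
proof -
  have "mem_bounded bound (\<lambda>_. 0)"
    by (simp add: mem_bounded_def)
  then show ?thesis
    using k_le_n by (simp add: run_simps ready_def)
qed

lemma greedy_fits_le: "greedy (fits t k \<pi> D) q \<le> k"
  by (induction q) (auto simp: fits_def)

definition looping :: "(nat \<Rightarrow> nat) \<Rightarrow> nat \<Rightarrow> nat \<Rightarrow> (nat \<Rightarrow> nat) \<Rightarrow> bool" where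
  "looping D J q m \<longleftrightarrow> ready m J \<and> m 8 = q + 2 \<and>
     m 9 = n + 2 + greedy (fits t k \<pi> D) q \<and> (\<forall>u. m (20 + u) = D u)"

lemma loop_body:
  assumes m: "looping D J q m" and q: "q < n"
  shows "arrives (\<lambda>(pc, m'). pc = 26 \<and> looping D J (Suc q) m') 15 (26, m)"
proof -
  define g where "g = greedy (fits t k \<pi> D) q"
  define u where "u = (if g < k then \<pi> (Suc g) else 0)"
  define w where "w = t (Suc q)"
  define a where "a = n + 2 + g"
  define b where "b = q + 2"
  have g: "g \<le> k"
    by (simp add: g_def greedy_fits_le)
  have u: "u \<le> k"
    using pi_range[of "Suc g"] by (simp add: u_def)
  have w: "1 \<le> w" "w \<le> n"
    using t_range[of "Suc q"] q by (simp_all add: w_def)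
  have r: "ready m J" and regs: "m 8 = b" "m 9 = a" and D: "D u = m (20 + u)" for u
    using m by (simp_all add: looping_def a_def b_def g_def)
  note r = readyD[OF r]
  have input: "input_at (encode n t k \<pi>) a = u" "input_at (encode n t k \<pi>) b = w"
    unfolding a_def b_def u_def w_def using q by (simp_all only: input_at_encode)
  have slot: "m (u + 20) = D u" "m (Suc (u + 20)) = D (Suc u)" "D u \<le> bound" "D (Suc u) \<le> bound"
    using mem_boundedD[OF r(1)] by (simp_all add: D add.commute)
  have ab: "a \<le> 2 * n + 2" "b \<le> n + 1" "u \<le> n"
    using q g u k_le_n by (simp_all add: a_def b_def)
  \<comment> \<open>The machine does not test \<open>v \<le> k\<close>. For \<open>g = k\<close> it
    compares \<open>w \<ge> 1\<close> with the slot from \<open>D 0\<close> to \<open>D 1\<close>,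
    which contains only 0.\<close>
  have fit: "fits t k \<pi> D (Suc g) (Suc q) \<longleftrightarrow> D u \<le> w \<and> w \<le> D (Suc u)"
  proof (cases "g < k")
    case False
    then have "u = 0" "D (Suc 0) = 0"
      using r by (simp_all add: u_def D)
    then show ?thesis
      using False w by (simp add: fits_def)
  qed (simp add: fits_def u_def w_def)
  have cont: "looping D J (Suc q) m'"
    if "ready m' J" "m' 8 = Suc b" "m' 9 = (if D u \<le> w \<and> w \<le> D (Suc u) then Suc a else a)"
      "\<forall>u. m' (20 + u) = m (20 + u)" for m'
    using that by (simp add: looping_def a_def b_def fit D flip: g_def)
  consider "D u > w" | "D u \<le> w" "D (Suc u) < w" | "D u \<le> w" "w \<le> D (Suc u)"
    by linarith
  then show ?thesis
  proof cases
    case 1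
    then have "runs_to (\<lambda>(pc, m'). pc = 26 \<and> looping D J (Suc q) m') 10 (26, m)"
      using r regs input slot w ab by (simp add: run_simps) (rule cont; simp add: ready_def)
    then show ?thesis
      by (rule steps_to_imp_reaches) simp
  next
    case 2
    then have "runs_to (\<lambda>(pc, m'). pc = 26 \<and> looping D J (Suc q) m') 14 (26, m)"
      using r regs input slot w ab by (simp add: run_simps) (rule cont; simp add: ready_def)
    then show ?thesis
      by (rule steps_to_imp_reaches) simp
  next
    case 3
    then have "runs_to (\<lambda>(pc, m'). pc = 26 \<and> looping D J (Suc q) m') 15 (26, m)"
      using r regs input slot w ab by (simp add: run_simps) (rule cont; simp add: ready_def)
    then show ?thesis
      by (rule steps_to_imp_reaches) simp
  qed
qed

lemma loop_runs:
  assumes "looping D J q m" "q \<le> n"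
  shows "arrives (\<lambda>(pc, m'). pc = 26 \<and> looping D J n m') (15 * (n - q)) (26, m)"
  using assms
proof (induction "n - q" arbitrary: q m)
  case 0
  then have "q = n"
    by simp
  moreover have "mem_bounded bound m"
    using "0.prems"(1) by (simp add: looping_def ready_def)
  ultimately have "runs_to (\<lambda>(pc, m'). pc = 26 \<and> looping D J n m') 0 (26, m)"
    using "0.prems"(1) by simp
  then show ?case
    by (rule steps_to_imp_reaches) simp
next
  case (Suc d)
  then have d: "q < n" "d = n - Suc q"
    by auto
  show ?case
  proof (rule reaches_trans[OF loop_body[OF Suc.prems(1) d(1)]])
    show "15 + 15 * (n - Suc q) \<le> 15 * (n - q)"
      using d by linarith
  qed (use Suc.hyps(1)[OF d(2)] d in auto)
qed

text \<open>A failed test preserves only the entries below \<open>J\<close>, because the sentinel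
  \<open>Suc n\<close> overwrites \<open>D J\<close>. Register 9 minus register 14 is nonzero
  exactly when all \<open>k\<close> pattern positions have been matched.\<close>

lemma check_runs:
  assumes m: "ready m J" and J: "2 \<le> J" "J \<le> k + 2"
  shows "arrives (\<lambda>(pc, m').
      if greedy (fits t k \<pi> ((\<lambda>u. m (20 + u))(J := Suc n))) n = k then pc = 54 \<and> m' 0 = 1 \<and> mem_bounded bound m'
      else pc = 48 \<and> ready m' J \<and> (\<forall>u<J. m' (20 + u) = m (20 + u))) (15 * n + 10) (23, m)"
    (is "arrives ?Q _ _")
proof -
  define D where "D = (\<lambda>u. m (20 + u))(J := Suc n)"
  note r = readyD[OF m]
  have start: "runs_to (\<lambda>(pc, m'). pc = 26 \<and> looping D J 0 m') 3 (23, m)"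
    using r J k_le_n by (simp add: run_simps looping_def ready_def D_def)
  have finish: "arrives ?Q (15 * n + 7) c" if entry: "case c of (pc, m') \<Rightarrow> pc = 26 \<and> looping D J 0 m'" for c
  proof -
    obtain m' where c: "c = (26, m')" and m': "looping D J 0 m'"
      using entry by (cases c) auto
    have "arrives ?Q 7 (pc, m')" if "pc = 26" and m': "looping D J n m'" for pc m'
    proof -
      define g where "g = greedy (fits t k \<pi> D) n"
      have g: "g \<le> k"
        by (simp add: g_def greedy_fits_le)
      have m'_ready: "ready m' J"
        using m' by (simp add: looping_def)
      have regs: "m' 8 = n + 2" "m' 9 = n + 2 + g"
        using m' by (simp_all add: looping_def g_def)
      have D: "m' (20 + u) = m (20 + u)" if "u < J" for u
        using m' that by (simp add: looping_def D_def)
      note r' = readyD[OF m'_ready]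
      show ?thesis
      proof (cases "g = k")
        case True
        then have "runs_to (\<lambda>(pc, m'). pc = 54 \<and> m' 0 = 1 \<and> mem_bounded bound m') 7 (26, m')"
          using r' regs k_le_n by (simp add: run_simps)
        then show ?thesis
          using True \<open>pc = 26\<close> by (auto simp: g_def D_def intro: steps_to_imp_reaches)
      next
        case False
        then have "runs_to (\<lambda>(pc, m'). pc = 48 \<and> ready m' J \<and> (\<forall>u<J. m' (20 + u) = m (20 + u))) 5 (26, m')"
          using r' regs g k_le_n D by (simp add: run_simps ready_def)
        then show ?thesis
          using False \<open>pc = 26\<close> by (auto simp: g_def D_def intro: steps_to_imp_reaches)
      qed
    qed
    then show ?thesis
      unfolding c by (intro reaches_trans[OF loop_runs[OF m'], where M = 7]) (auto split del: if_split)
  qed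
  show ?thesis
    by (rule steps_then[OF start finish]) simp_all
qed

section \<open>Simulation of the search by backtracking\<close>

lemma backtrack_runs:
  assumes m: "ready m (J + 2)" and J: "2 \<le> J" "J \<le> k" and x: "m (20 + J) = x" "x \<le> n"
  shows "runs_to (\<lambda>(pc, m'). pc = 11 \<and> ready m' J \<and> m' 6 = x + 1 \<and>
    (\<forall>u. m' (20 + u) = m (20 + u))) 6 (48, m)"
proof -
  note r = readyD[OF m]
  show ?thesis
    using r J k_le_n x by (simp add: run_simps ready_def)
qed

lemma push_runs:
  assumes m: "ready m J" and J: "2 \<le> J" "J \<le> k" and x: "m 6 = x" "x \<le> n"
  shows "runs_to (\<lambda>(pc, m'). pc = 11 \<and> ready m' (J + 2) \<and> m' 6 = x + 2 \<and>
    (\<lambda>u. m' (20 + u)) = (\<lambda>u. m (20 + u))(J := x, Suc J := x)) 10 (11, m)"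
proof -
  note r = readyD[OF m]
  show ?thesis
    using r J k_le_n x by (simp add: run_simps ready_def fun_eq_iff)
qed

text \<open>A failed first branch leaves stale entries at \<open>J\<close> and above. They do not
  affect the second branch: index \<open>J\<close> and later ones are set by a placement or by the
  sentinel before a test reads them.\<close>

lemma search_cong:
  assumes "\<And>u. u < J \<Longrightarrow> D u = D' u" "J \<le> k + 2"
  shows "search n t k \<pi> J x D = search n t k \<pi> J x D'"
  using assms
proof (induction "Suc n - x" arbitrary: J x D D' rule: less_induct)
  case less
  have "fits t k \<pi> (D(J := Suc n)) v q = fits t k \<pi> (D'(J := Suc n)) v q"
    if "k < J" "1 \<le> v" for v q
  proof (cases "v \<le> k")
    case True
    then have "\<pi> v < J" "Suc (\<pi> v) \<le> J"
      using pi_range[of v] that by auto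
    then show ?thesis
      using less.prems(1)[of "\<pi> v"] less.prems(1)[of "Suc (\<pi> v)"]
      by (auto simp: fits_def le_less)
  qed (simp add: fits_def)
  then have "greedy (fits t k \<pi> (D(J := Suc n))) q = greedy (fits t k \<pi> (D'(J := Suc n))) q"
    if "k < J" for q
    using that by (induction q) auto
  moreover have "search n t k \<pi> (J + 2) (x + 2) (D(J := x, Suc J := x)) =
      search n t k \<pi> (J + 2) (x + 2) (D'(J := x, Suc J := x))" if "J \<le> k" "x \<le> n"
    using that less.prems by (intro less.hyps) auto
  moreover have "search n t k \<pi> J (x + 1) D = search n t k \<pi> J (x + 1) D'" if "x \<le> n"
    using that less.prems by (intro less.hyps) auto
  ultimately show ?case
    by (simp add: search.simps[of n t k \<pi> J x])
qed

text \<open>\<open>D\<close> doubles as the recursion stack: after a failed first branch the last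
  choice is read back from \<open>D J\<close>, and the second branch is a tail call. Each node pays
  for \<open>15 * n + 20\<close> steps: a leaf takes at most \<open>15 * n + 13\<close>, a dead end
  5, an inner node 10 for placing and 6 for backtracking.\<close>

lemma search_runs:
  assumes "ready m J" "2 \<le> J" "J \<le> k + 2" "m 6 = x" "x \<le> n + 2"
  shows "arrives (\<lambda>(pc, m').
      if search n t k \<pi> J x (\<lambda>u. m (20 + u)) then pc = 54 \<and> m' 0 = 1 \<and> mem_bounded bound m'
      else pc = 48 \<and> ready m' J \<and> (\<forall>u<J. m' (20 + u) = m (20 + u)))
    (visits n k J x * (15 * n + 20)) (11, m)"
  using assms
proof (induction "Suc n - x" arbitrary: J x m rule: less_induct)
  case less
  let ?D = "\<lambda>u. m (20 + u)"
  let ?K = "15 * n + 20"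
  let ?Q = "\<lambda>(pc, m'). if search n t k \<pi> J x ?D then pc = 54 \<and> m' 0 = 1 \<and> mem_bounded bound m'
      else pc = 48 \<and> ready m' J \<and> (\<forall>u<J. m' (20 + u) = m (20 + u))"
  note r = readyD[OF less.prems(1)]
  consider "k < J" | "J \<le> k" "n < x" | "J \<le> k" "x \<le> n"
    by linarith
  then show "arrives ?Q (visits n k J x * ?K) (11, m)"
  proof cases
    case 1
    then have search: "search n t k \<pi> J x ?D \<longleftrightarrow> greedy (fits t k \<pi> (?D(J := Suc n))) n = k"
      by (simp add: search.simps)
    have *: "runs_to (\<lambda>(pc, m'). pc = 23 \<and> ready m' J \<and> (\<lambda>u. m' (20 + u)) = ?D) 3 (11, m)"
      using 1 r less.prems k_le_n by (simp add: run_simps ready_def)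
    have "arrives ?Q (15 * n + 10) (23, m')" if m': "ready m' J" "(\<lambda>u. m' (20 + u)) = ?D" for m'
    proof -
      have "\<And>u. m' (20 + u) = m (20 + u)"
        using m'(2) by metis
      then show ?thesis
        using check_runs[OF m'(1) less.prems(2,3)]
        by (simp add: search cong: if_cong split del: if_split)
    qed
    then show ?thesis
      using 1 by (intro steps_then[OF *, where M = "15 * n + 10"]) (auto simp: visits.simps split del: if_split)
  next
    case 2
    then have "\<not> search n t k \<pi> J x ?D"
      by (simp add: search.simps)
    then have "runs_to ?Q 5 (11, m)"
      using 2 r less.prems k_le_n by (simp add: run_simps ready_def)
    then show ?thesis
      using 2 by (intro steps_to_imp_reaches) (auto simp: visits.simps)
  next
    case 3
    let ?D' = "?D(J := x, Suc J := x)"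
    let ?found = "search n t k \<pi> (J + 2) (x + 2) ?D'"
    have search: "search n t k \<pi> J x ?D \<longleftrightarrow> ?found \<or> search n t k \<pi> J (x + 1) ?D"
      using 3 by (simp add: search.simps[of n t k \<pi> J x])
    have visits: "visits n k J x = 1 + visits n k (J + 2) (x + 2) + visits n k J (x + 1)"
      using 3 by (simp add: visits.simps[of n k J x])
    let ?Q1 = "\<lambda>(pc, m'). pc = 11 \<and> ready m' (J + 2) \<and> m' 6 = x + 2 \<and> (\<lambda>u. m' (20 + u)) = ?D'"
    let ?Q2 = "\<lambda>(pc, m'). if ?found then pc = 54 \<and> m' 0 = 1 \<and> mem_bounded bound m'
      else pc = 48 \<and> ready m' (J + 2) \<and> (\<forall>u<J + 2. m' (20 + u) = ?D' u)"
    have push: "runs_to ?Q1 10 (11, m)"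
      using push_runs less.prems 3 by blast
    have pushed_search: "arrives ?Q2 (visits n k (J + 2) (x + 2) * ?K) c" if pushed: "?Q1 c" for c
    proof -
      obtain m' where c: "c = (11, m')" and m': "ready m' (J + 2)" "m' 6 = x + 2"
        and D': "(\<lambda>u. m' (20 + u)) = ?D'"
        using pushed by (cases c) auto
      have "m' (20 + u) = ?D' u" for u
        using D' by metis
      then show ?thesis
        using less.hyps[of "x + 2" m' "J + 2"] m' 3 unfolding c
        by (simp del: fun_upd_apply cong: if_cong split del: if_split)
    qed
    have backtrack: "arrives ?Q (6 + visits n k J (x + 1) * ?K) c" if "?Q2 c" for c
    proof (cases ?found)
      case True
      obtain m' where "c = (54, m')" "m' 0 = 1" "mem_bounded bound m'"
        using \<open>?Q2 c\<close> True by (cases c) auto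
      then have "runs_to ?Q 0 c"
        using True search by simp
      then show ?thesis
        by (rule steps_to_imp_reaches) simp
    next
      case False
      then obtain m' where c: "c = (48, m')" and m': "ready m' (J + 2)"
        and D': "\<forall>u<J + 2. m' (20 + u) = ?D' u"
        using \<open>?Q2 c\<close> by (cases c) auto
      let ?Q3 = "\<lambda>(pc, m''). pc = 11 \<and> ready m'' J \<and> m'' 6 = x + 1 \<and>
        (\<forall>u. m'' (20 + u) = m' (20 + u))"
      have unwind: "runs_to ?Q3 6 (48, m')"
        using backtrack_runs[OF m' less.prems(2) 3(1), of x] D' 3 by simp
      have "arrives ?Q (visits n k J (x + 1) * ?K) c" if restored: "?Q3 c" for c
      proof -
        obtain m'' where c: "c = (11, m'')" and m'': "ready m'' J" "m'' 6 = x + 1"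
          and D'': "\<forall>u. m'' (20 + u) = m' (20 + u)"
          using restored by (cases c) auto
        have same: "m'' (20 + u) = m (20 + u)" if "u < J" for u
          using D'' D' that by simp
        then have "search n t k \<pi> J (x + 1) (\<lambda>u. m'' (20 + u)) = search n t k \<pi> J (x + 1) ?D"
          using less.prems(3) by (intro search_cong)
        moreover have "(\<forall>u<J. f (20 + u) = m'' (20 + u)) \<longleftrightarrow> (\<forall>u<J. f (20 + u) = m (20 + u))"
          for f :: "nat \<Rightarrow> nat"
          using same by auto
        moreover have "Suc n - (x + 1) < Suc n - x"
          using 3 by linarith
        ultimately show ?thesis
          using less.hyps[of "x + 1" m'' J] m'' less.prems 3 False
          unfolding c by (simp add: search cong: if_cong split del: if_split)
      qed
      then show ?thesis
        unfolding c by (rule steps_then[OF unwind]) simp_all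
    qed
    show ?thesis
      by (rule steps_then[OF push, OF reaches_trans[OF pushed_search backtrack order_refl]])
        (auto simp: visits algebra_simps)
  qed
qed

lemma program_runs:
  "arrives (\<lambda>c. halted containment_program c \<and>
      snd c 0 = (if search n t k \<pi> 2 1 (\<lambda>_. 0) then 1 else 0))
    (visits n k 2 1 * (15 * n + 20) + 13) (0, \<lambda>_. 0)" (is "arrives ?Q _ _")
proof (rule steps_then[OF init_runs])
  fix c :: config
  assume "case c of (pc, m) \<Rightarrow> pc = 11 \<and> ready m 2 \<and> m 6 = 1 \<and> (\<forall>u. m (20 + u) = 0)"
  then obtain m where c: "c = (11, m)" and m: "ready m 2" "m 6 = 1" "\<forall>u. m (20 + u) = 0"
    by (cases c) auto
  show "arrives ?Q (visits n k 2 1 * (15 * n + 20) + 2) c"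
    unfolding c
  proof (rule reaches_trans[OF search_runs[OF m(1)]])
    fix c :: config
    assume *: "case c of (pc, m') \<Rightarrow> if search n t k \<pi> 2 1 (\<lambda>u. m (20 + u)) then pc = 54 \<and> m' 0 = 1 \<and> mem_bounded bound m'
      else pc = 48 \<and> ready m' 2 \<and> (\<forall>u<2. m' (20 + u) = m (20 + u))"
    show "arrives ?Q 2 c"
    proof (cases "search n t k \<pi> 2 1 (\<lambda>_. 0)")
      case True
      obtain m' where "c = (54, m')" "m' 0 = 1" "mem_bounded bound m'"
        using * True m(3) by (cases c) auto
      then have "runs_to ?Q 0 c"
        using True by (simp add: halted_def containment_program_def)
      then show ?thesis
        by (rule steps_to_imp_reaches) simp
    next
      case False
      then obtain m' where "c = (48, m')" "ready m' 2"
        using * m(3) by (cases c) auto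
      \<comment> \<open>At the root, register 5 equals register 15, so backtracking leaves the
        program with register 0 still 0.\<close>
      then have "runs_to ?Q 2 c"
        using False readyD[of m' 2] by (simp add: run_simps)
      then show ?thesis
        by (rule steps_to_imp_reaches) simp
    qed
  qed (use m in auto)
qed simp


subsection \<open>Correctness\<close>

text \<open>If \<open>D\<close> is monotone, slots of different pattern values overlap at most in
  end points, so the text values are weakly in the right order; injectivity of \<open>t\<close>
  makes the order strict.\<close>

lemma contains_if_greedy:
  assumes mono: "\<And>u v. u \<le> v \<Longrightarrow> v \<le> k + 1 \<Longrightarrow> D u \<le> D v"
    and greedy: "greedy (fits t k \<pi> D) n = k"
  shows "perm_contains n t k \<pi>"
proof -
  obtain i where i: "strict_mono_on {1..k} i" "i ` {1..k} \<subseteq> {1..n}"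
    and fit: "\<And>j. j \<in> {1..k} \<Longrightarrow> fits t k \<pi> D j (i j)"
    using greedy_sound[of "fits t k \<pi> D" n] unfolding greedy by blast
  have less: "t (i j) < t (i l)" if "j \<in> {1..k}" "l \<in> {1..k}" "\<pi> j < \<pi> l" for j l
  proof -
    have "t (i j) \<le> D (Suc (\<pi> j))"
      using fit[OF that(1)] by (simp add: fits_def)
    also have "\<dots> \<le> D (\<pi> l)"
      using that pi_range[of l] by (intro mono) auto
    also have "\<dots> \<le> t (i l)"
      using fit[OF that(2)] by (simp add: fits_def)
    finally have "t (i j) \<le> t (i l)" .
    moreover have "i j \<noteq> i l"
      using strict_mono_on_imp_inj_on[OF i(1)] that by (auto dest: inj_onD)
    then have "t (i j) \<noteq> t (i l)"
      using permutes_inj[OF t] by (auto dest: injD)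
    ultimately show ?thesis
      by simp
  qed
  have "t (i j) < t (i l) \<longleftrightarrow> \<pi> j < \<pi> l" if "j \<in> {1..k}" "l \<in> {1..k}" for j l
  proof -
    have "\<pi> j < \<pi> l \<or> \<pi> l < \<pi> j \<or> j = l"
      using permutes_inj[OF pi] by (metis injD nat_neq_iff)
    then show ?thesis
      using less[OF that] less[OF that(2,1)] by auto
  qed
  then show ?thesis
    using i by (auto simp: perm_contains_def)
qed

text \<open>The bound \<open>D u \<le> x\<close> keeps \<open>D\<close> monotone when
  \<open>x\<close> is placed, and \<open>D u \<le> n\<close> keeps it monotone under the final
  sentinel.\<close>

lemma search_sound:
  assumes "search n t k \<pi> J x D" "2 \<le> J" "J \<le> k + 2"
    and "\<And>u v. u \<le> v \<Longrightarrow> v < J \<Longrightarrow> D u \<le> D v" "\<And>u. u < J \<Longrightarrow> D u \<le> n \<and> D u \<le> x"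
  shows "perm_contains n t k \<pi>"
  using assms
proof (induction "Suc n - x" arbitrary: J x D rule: less_induct)
  case less
  note mono = less.prems(4) and le = less.prems(5)
  consider "k < J" | "J \<le> k" "n < x" | "J \<le> k" "x \<le> n"
    by linarith
  then show ?case
  proof cases
    case 1
    have "(D(J := Suc n)) u \<le> (D(J := Suc n)) v" if "u \<le> v" "v \<le> k + 1" for u v
      using that 1 mono[of u v] le[of u] by (cases "v = J") auto
    moreover have "greedy (fits t k \<pi> (D(J := Suc n))) n = k"
      using 1 less.prems(1) by (simp add: search.simps)
    ultimately show ?thesis
      by (rule contains_if_greedy)
  next
    case 2
    then show ?thesis
      using less.prems(1) by (simp add: search.simps)
  next
    case 3
    then consider "search n t k \<pi> (J + 2) (x + 2) (D(J := x, Suc J := x))"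
      | "search n t k \<pi> J (x + 1) D"
      using less.prems(1) by (auto simp: search.simps[of n t k \<pi> J x])
    then show ?thesis
    proof cases
      case 1
      show ?thesis
      proof (rule less.hyps[OF _ 1])
        show "(D(J := x, Suc J := x)) u \<le> (D(J := x, Suc J := x)) v" if "u \<le> v" "v < J + 2" for u v
          using that mono[of u v] le[of u] by auto
        show "(D(J := x, Suc J := x)) u \<le> n \<and> (D(J := x, Suc J := x)) u \<le> x + 2"
          if "u < J + 2" for u
          using that le[of u] 3 by auto
      qed (use 3 in auto)
    next
      case 2
      show ?thesis
        by (rule less.hyps[OF _ 2]) (use 3 less.prems mono le in \<open>auto simp: le_SucI\<close>)
    qed
  qed
qed

text \<open>A copy dictates a successful branch: with \<open>P u\<close> the text value that plays
  \<open>u\<close>, candidates below \<open>P J\<close> are skipped and \<open>J\<close> is placed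
  at \<open>P J\<close>. At the leaf the copy itself fits all slots, so the greedy sweep matches
  everything.\<close>

lemma search_complete:
  assumes "perm_contains n t k \<pi>"
  shows "search n t k \<pi> 2 1 (\<lambda>_. 0)"
proof -
  obtain i where i: "strict_mono_on {1..k} i" "i ` {1..k} \<subseteq> {1..n}"
    and iff: "\<And>j l. j \<in> {1..k} \<Longrightarrow> l \<in> {1..k} \<Longrightarrow> t (i j) < t (i l) \<longleftrightarrow> \<pi> j < \<pi> l"
    using assms unfolding perm_contains_def by blast
  define P where "P u = t (i (inv \<pi> u))" for u
  have inv_pi: "inv \<pi> u \<in> {1..k}" "\<pi> (inv \<pi> u) = u" if "u \<in> {1..k}" for u
    using that permutes_in_image[OF permutes_inv[OF pi], of u] permutes_inverses(1)[OF pi] by auto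
  have P_pi: "P (\<pi> j) = t (i j)" for j
    by (simp add: P_def permutes_inverses(2)[OF pi])
  have P_less: "P u < P v" if "u < v" "1 \<le> u" "v \<le> k" for u v
    using that iff[of "inv \<pi> u" "inv \<pi> v"] inv_pi[of u] inv_pi[of v] by (simp add: P_def)
  have P_le: "P u \<le> P v" if "u \<le> v" "1 \<le> u" "v \<le> k" for u v
    using that P_less[of u v] by (cases "u = v") auto
  have P_le_n: "P u \<le> n" if "u \<in> {1..k}" for u
  proof -
    have "i (inv \<pi> u) \<in> {1..n}"
      using i(2) inv_pi(1)[OF that] by blast
    then show ?thesis
      using t_range by (simp add: P_def)
  qed
  have "search n t k \<pi> J x D"
    if "even J" "2 \<le> J" "J \<le> k + 2" "J \<le> k \<Longrightarrow> x \<le> P J"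
      and "\<And>u. u < J \<Longrightarrow> D u = (if u < 2 then 0 else P (2 * (u div 2)))" for J x D
    using that
  proof (induction "Suc n - x" arbitrary: J x D rule: less_induct)
    case less
    note J = less.prems(1-3) and x = less.prems(4) and D = less.prems(5)
    show ?case
    proof (cases "k < J")
      case True
      let ?D = "D(J := Suc n)"
      have "fits t k \<pi> ?D j (i j)" if "j \<in> {1..k}" for j
      proof -
        define u where "u = \<pi> j"
        have u: "1 \<le> u" "u \<le> k" "P u \<le> n"
          using pi_range[OF that] P_le_n[of u] by (auto simp: u_def)
        \<comment> \<open>The slot of \<open>u\<close> ends at the images of the nearest even values
          from below and above, or at 0 and the sentinel where these do not exist.\<close>
        have "?D u \<le> P u"
          using u True D[of u] P_le[of "2 * (u div 2)" u] by (cases "u < 2") auto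
        moreover have "P u \<le> ?D (Suc u)"
        proof (cases "Suc u = J")
          case False
          have "Suc u < J"
            using False u True by simp
          \<comment> \<open>As \<open>J\<close> is even, \<open>Suc u < J\<close> puts this even
            value at most at \<open>J - 2\<close>.\<close>
          moreover have "u \<le> 2 * (Suc u div 2)" "2 * (Suc u div 2) \<le> k"
            using J u \<open>Suc u < J\<close> by presburger+
          ultimately show ?thesis
            using u D[of "Suc u"] P_le[of u "2 * (Suc u div 2)"] by auto
        qed (use u in simp)
        ultimately show ?thesis
          using that by (simp add: fits_def P_pi[symmetric] u_def)
      qed
      then have "k \<le> greedy (fits t k \<pi> ?D) n"
        using i by (intro greedy_optimal) auto
      then have "greedy (fits t k \<pi> ?D) n = k"
        using greedy_fits_le le_antisym by blast
      then show ?thesis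
        using True by (simp add: search.simps)
    next
      case False
      then have "x \<le> P J" "P J \<le> n"
        using x P_le_n[of J] J by auto
      then have x_le: "x \<le> n"
        by simp
      show ?thesis
      proof (cases "x = P J")
        case True
        \<comment> \<open>The image of \<open>J + 1\<close> lies strictly between, so continuing
          with \<open>x + 2\<close> does not skip \<open>P (J + 2)\<close>.\<close>
        have "P J + 2 \<le> P (J + 2)" if "J + 2 \<le> k"
          using P_less[of J "J + 1"] P_less[of "J + 1" "J + 2"] that J by linarith
        then have "search n t k \<pi> (J + 2) (x + 2) (D(J := x, Suc J := x))"
          using True J False x_le D by (intro less.hyps) auto
        then show ?thesis
          using False x_le by (simp add: search.simps[of n t k \<pi> J x])
      next
        case False
        then have "search n t k \<pi> J (x + 1) D"
          using J x x_le D by (intro less.hyps) (auto simp: Suc_le_eq le_less)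
        then show ?thesis
          using \<open>\<not> k < J\<close> x_le by (simp add: search.simps[of n t k \<pi> J x])
      qed
    qed
  qed
  moreover have "1 \<le> P 2" if "2 \<le> k"
    using P_less[of 1 2] that by simp
  ultimately show ?thesis
    by simp
qed

lemma search_iff_contains: "search n t k \<pi> 2 1 (\<lambda>_. 0) \<longleftrightarrow> perm_contains n t k \<pi>"
  using search_sound[of 2 1 "\<lambda>_. 0"] search_complete by auto

lemmas program_result = reaches_halt[OF program_runs operands_containment_program input_at_le,
  unfolded search_iff_contains]

end


section \<open>Running time\<close>

text \<open>The summand \<open>- 1\<close> absorbs the node itself in the Fibonacci recursion.
  Starting the exponent at \<open>n + 2 - x\<close> avoids truncation in the recursive calls, where
  \<open>x \<le> n\<close>.\<close>

lemma visits_exponential: "real (visits n k J x) \<le> 2 * 1.61804 ^ (n + 2 - x) - 1"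
proof (induction n k J x rule: visits.induct)
  case (1 n k J x)
  show ?case
  proof (cases "k < J \<or> n < x")
    case True
    have "(1 :: real) \<le> 1.61804 ^ (n + 2 - x)"
      by (rule one_le_power) simp
    then show ?thesis
      using True by (simp add: visits.simps)
  next
    case False
    define e where "e = n - x"
    have e: "n + 2 - x = e + 2" "n + 2 - (x + 1) = e + 1" "n + 2 - (x + 2) = e"
      using False by (auto simp: e_def)
    have "1 + (2 * 1.61804 ^ e - 1) + (2 * 1.61804 ^ (e + 1) - 1) = 2 * 1.61804 ^ e * (2.61804 :: real) - 1"
      by simp
    \<comment> \<open>This is \<open>a\<^sup>2 \<ge> a + 1\<close>; the base lies just above the
      golden ratio.\<close>
    also have "\<dots> \<le> 2 * 1.61804 ^ e * 1.61804\<^sup>2 - 1"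
      by (simp add: power2_eq_square)
    finally have "1 + (2 * 1.61804 ^ e - 1) + (2 * 1.61804 ^ (e + 1) - 1) \<le> 2 * 1.61804 ^ (e + 2) - (1 :: real)"
      by (simp add: power_add)
    moreover have "visits n k J x = 1 + visits n k (J + 2) (x + 2) + visits n k J (x + 1)"
      using False by (simp add: visits.simps[of n k J x])
    ultimately show ?thesis
      using 1[OF False] unfolding e by simp
  qed
qed

text \<open>One more candidate value adds the node and its placing branch, together at most
  \<open>2 * n * p\<close>; this is the slope 2 in the number \<open>m\<close> of remaining
  candidates. Each placement costs one factor \<open>n\<close>.\<close>

lemma visits_polynomial:
  assumes "1 \<le> x" "1 \<le> n"
  shows "visits n k J x \<le> (2 * (n + 1 - x) + 1) * n ^ ((k + 2 - J) div 2)"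
  using assms
proof (induction n k J x rule: visits.induct)
  case (1 n k J x)
  show ?case
  proof (cases "k < J \<or> n < x")
    case True
    then show ?thesis
      using "1.prems"(2) one_le_power[of n] by (auto simp: visits.simps Suc_le_eq)
  next
    case False
    define j where "j = (k - J) div 2"
    define p where "p = n ^ j"
    define m where "m = n + 1 - x"
    have j: "(k + 2 - (J + 2)) div 2 = j" "(k + 2 - J) div 2 = Suc j"
      using False by (auto simp: j_def)
    have m: "n + 1 - (x + 2) = m - 2" "n + 1 - (x + 1) = m - 1" "1 \<le> m" "m \<le> n"
      using False 1(3,4) by (auto simp: m_def)
    have "1 \<le> p"
      using 1(4) by (simp add: p_def)
    have "1 + (2 * (m - 2) + 1) * p \<le> (2 + 2 * (m - 2)) * p"
      using \<open>1 \<le> p\<close> by simp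
    also have "\<dots> \<le> (2 * n) * p"
      using m by (intro mult_right_mono) auto
    finally have "1 + (2 * (m - 2) + 1) * p + (2 * (m - 1) + 1) * (n * p) \<le>
        (2 + (2 * (m - 1) + 1)) * (n * p)"
      by (simp add: algebra_simps)
    also have "2 + (2 * (m - 1) + 1) = 2 * m + 1"
      using m by simp
    finally have "1 + (2 * (m - 2) + 1) * p + (2 * (m - 1) + 1) * (n * p) \<le> (2 * m + 1) * (n * p)" .
    moreover have "visits n k J x = 1 + visits n k (J + 2) (x + 2) + visits n k J (x + 1)"
      using False by (simp add: visits.simps[of n k J x])
    moreover have "visits n k (J + 2) (x + 2) \<le> (2 * (m - 2) + 1) * p"
      using 1(1)[OF False] 1(4) unfolding m j p_def by simp
    moreover have "visits n k J (x + 1) \<le> (2 * (m - 1) + 1) * (n * p)"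
      using 1(2)[OF False] 1(4) unfolding m j p_def by simp
    ultimately have "visits n k J x \<le> (2 * m + 1) * (n * p)"
      by linarith
    then show ?thesis
      by (simp only: j p_def power_Suc flip: m_def)
  qed
qed

section \<open>Worst-case bounds and asymptotics\<close>

lemma worst_case_le:
  assumes "\<And>t \<pi>. t permutes {1..n} \<Longrightarrow> \<pi> permutes {1..k} \<Longrightarrow> f (encode n t k \<pi>) \<le> b"
  shows "worst_case f n k \<le> b"
  unfolding worst_case_def using worst_case_set[of f n k] assms by (subst Max_le_iff) auto

text \<open>The constant is \<open>48 * 315\<close>: at most \<open>48 * n\<close> steps per node,
  including the 13 steps outside the search, and cost at most \<open>315 * n\<close> per
  step.\<close>

lemma program_time_le:
  assumes "1 \<le> n" "k \<le> n"
  shows "worst_case (ram_time containment_program) n k \<le> 15120 * n\<^sup>2 * visits n k 2 1"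
proof (rule worst_case_le)
  fix t \<pi> :: "nat \<Rightarrow> nat"
  assume "t permutes {1..n}" "\<pi> permutes {1..k}"
  then interpret containment_instance n k t \<pi>
    using assms by unfold_locales
  have "1 \<le> visits n k 2 1"
    by (subst visits.simps) simp
  then have "visits n k 2 1 * (15 * n + 20) + 13 \<le> visits n k 2 1 * (15 * n + 33)"
    by (simp add: algebra_simps)
  also have "\<dots> \<le> visits n k 2 1 * (48 * n)"
    using assms by (intro mult_left_mono) auto
  finally have "visits n k 2 1 * (15 * n + 20) + 13 \<le> visits n k 2 1 * (48 * n)" .
  moreover have "5 * (bound + 1) \<le> 315 * n"
    using assms by simp
  ultimately have "(visits n k 2 1 * (15 * n + 20) + 13) * (5 * (bound + 1)) \<le>
      visits n k 2 1 * (48 * n) * (315 * n)"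
    by (rule mult_mono) simp_all
  then show "ram_time containment_program (encode n t k \<pi>) \<le> 15120 * n\<^sup>2 * visits n k 2 1"
    using program_result(3) by (simp add: power2_eq_square mult_ac)
qed

lemma program_space_le:
  assumes "1 \<le> n" "k \<le> n"
  shows "worst_case (ram_space containment_program) n k \<le> 7938 * n\<^sup>2"
proof (rule worst_case_le)
  fix t \<pi> :: "nat \<Rightarrow> nat"
  assume "t permutes {1..n}" "\<pi> permutes {1..k}"
  then interpret containment_instance n k t \<pi>
    using assms by unfold_locales
  have "ram_space containment_program (encode n t k \<pi>) \<le> 2 * (bound + 1)\<^sup>2"
    by (rule program_result(4))
  also have "\<dots> \<le> 2 * (63 * n)\<^sup>2"
    using assms by (intro mult_left_mono power_mono) auto
  finally show "ram_space containment_program (encode n t k \<pi>) \<le> 7938 * n\<^sup>2"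
    by (simp add: power_mult_distrib)
qed

theorem theorem2:
  "\<exists>P. decides_containment P \<and>
     (\<exists>d. (\<lambda>n. real (MAX k\<in>{..n}. worst_case (ram_space P) n k)) \<in> O(\<lambda>n. real n ^ d)) \<and>
     (\<exists>(e :: nat \<Rightarrow> real) (C :: real). e \<in> o(\<lambda>k. real k) \<and>
        (\<forall>n k. 1 \<le> n \<and> k \<le> n \<longrightarrow>
           real (worst_case (ram_time P) n k) \<le> C * real n powr (real k / 2 + e k))) \<and>
     (\<lambda>n. real (MAX k\<in>{..n}. worst_case (ram_time P) n k)) \<in> O(\<lambda>n. (1.6181 :: real) ^ n)"
proof (intro exI[of _ containment_program] conjI)
  show "decides_containment containment_program"
    unfolding decides_containment_def
  proof (intro allI impI)
    fix n k :: nat and t \<pi> :: "nat \<Rightarrow> nat"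
    assume "t permutes {1..n} \<and> \<pi> permutes {1..k} \<and> k \<le> n"
    then interpret containment_instance n k t \<pi>
      by unfold_locales auto
    show "ram_halts containment_program (encode n t k \<pi>) \<and>
        ram_output containment_program (encode n t k \<pi>) = (if perm_contains n t k \<pi> then 1 else 0)"
      using program_result(1,2) by simp
  qed
next
  have "\<forall>\<^sub>F n in sequentially.
      norm (real (MAX k\<in>{..n}. worst_case (ram_space containment_program) n k)) \<le> 7938 * norm (real n ^ 2)"
    using eventually_ge_at_top[of 1]
  proof eventually_elim
    case (elim n)
    then have "(MAX k\<in>{..n}. worst_case (ram_space containment_program) n k) \<le> 7938 * n\<^sup>2"
      by (intro Max.boundedI) (auto intro: program_space_le)
    then have "real (MAX k\<in>{..n}. worst_case (ram_space containment_program) n k) \<le> real (7938 * n\<^sup>2)"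
      by (rule of_nat_mono)
    then show ?case
      by simp
  qed
  then show "\<exists>d. (\<lambda>n. real (MAX k\<in>{..n}. worst_case (ram_space containment_program) n k))
      \<in> O(\<lambda>n. real n ^ d)"
    by (intro exI[of _ 2] bigoI)
next
  \<comment> \<open>Of the three extra powers of \<open>n\<close>, two pay for the cost per node and
    one comes from the bound on the number of nodes. A constant excess in the exponent is
    \<open>o(k)\<close>.\<close>
  have "real (worst_case (ram_time containment_program) n k) \<le> 45360 * real n powr (real k / 2 + 3)"
    if n: "1 \<le> n" and k: "k \<le> n" for n k
  proof -
    have "visits n k 2 1 \<le> (2 * n + 1) * n ^ (k div 2)"
      using visits_polynomial[of 1 n k 2] n by simp
    also have "\<dots> \<le> 3 * n * n ^ (k div 2)"
      using n by (intro mult_right_mono) auto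
    finally have "15120 * n\<^sup>2 * visits n k 2 1 \<le> 45360 * (n ^ 3 * n ^ (k div 2))"
      by (simp add: power2_eq_square power3_eq_cube mult_ac)
    then have "worst_case (ram_time containment_program) n k \<le> 45360 * n ^ (k div 2 + 3)"
      using program_time_le[OF n k] by (simp add: power_add mult_ac)
    then have "real (worst_case (ram_time containment_program) n k) \<le> real (45360 * n ^ (k div 2 + 3))"
      by (rule of_nat_mono)
    then have "real (worst_case (ram_time containment_program) n k) \<le> 45360 * real n ^ (k div 2 + 3)"
      by simp
    also have "real n ^ (k div 2 + 3) = real n powr real (k div 2 + 3)"
      using n by (subst powr_realpow) auto
    also have "\<dots> \<le> real n powr (real k / 2 + 3)"
      using n by (intro powr_mono) auto
    finally show ?thesis
      by simp
  qed
  moreover have "(\<lambda>_. 3) \<in> o(\<lambda>k. real k)"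
    by real_asymp
  ultimately show "\<exists>(e :: nat \<Rightarrow> real) (C :: real). e \<in> o(\<lambda>k. real k) \<and>
      (\<forall>n k. 1 \<le> n \<and> k \<le> n \<longrightarrow>
         real (worst_case (ram_time containment_program) n k) \<le> C * real n powr (real k / 2 + e k))"
    by (intro exI[of _ "\<lambda>_. 3"] exI[of _ 45360]) auto
next
  have "\<forall>\<^sub>F n in sequentially. norm (real (MAX k\<in>{..n}. worst_case (ram_time containment_program) n k))
      \<le> 50000 * norm (real n ^ 2 * 1.61804 ^ n)"
    using eventually_ge_at_top[of 1]
  proof eventually_elim
    case (elim n)
    have "real (worst_case (ram_time containment_program) n k) \<le> 50000 * (real n ^ 2 * 1.61804 ^ n)"
      if "k \<le> n" for k
    proof -
      have "real (worst_case (ram_time containment_program) n k) \<le> real (15120 * n\<^sup>2 * visits n k 2 1)"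
        using program_time_le[OF elim that] by (rule of_nat_mono)
      also have "\<dots> = 15120 * real n ^ 2 * real (visits n k 2 1)"
        by simp
      also have "\<dots> \<le> 15120 * real n ^ 2 * (2 * 1.61804 ^ (n + 1))"
        using visits_exponential[of n k 2 1] by (intro mult_left_mono) auto
      \<comment> \<open>The constant exceeds \<open>15120 * 2 * 1.61804\<close>.\<close>
      also have "\<dots> \<le> 50000 * (real n ^ 2 * 1.61804 ^ n)"
        by simp
      finally show ?thesis .
    qed
    moreover obtain k where "k \<le> n" and
      "(MAX k\<in>{..n}. worst_case (ram_time containment_program) n k) =
        worst_case (ram_time containment_program) n k"
      using Max_in[of "worst_case (ram_time containment_program) n ` {..n}"] by fastforce
    ultimately show ?case
      by simp
  qed
  then have "(\<lambda>n. real (MAX k\<in>{..n}. worst_case (ram_time containment_program) n k))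
      \<in> O(\<lambda>n. real n ^ 2 * 1.61804 ^ n)"
    by (rule bigoI)
  \<comment> \<open>The gap between 1.61804 and 1.6181 swallows the factor
    \<open>n ^ 2\<close>.\<close>
  also have "(\<lambda>n. real n ^ 2 * 1.61804 ^ n) \<in> O(\<lambda>n. (1.6181 :: real) ^ n)"
    by real_asymp
  finally show "(\<lambda>n. real (MAX k\<in>{..n}. worst_case (ram_time containment_program) n k))
      \<in> O(\<lambda>n. (1.6181 :: real) ^ n)" .
qed

end
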